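(* Let $X$ be a semiuniform semigroup acting semiuniformly on a uniform space $Y$. Let $\mu,\mu'\in \mathbf{M}(X)$ and $\nu\in\mathbf{M}(Y)$. Then $(\mu\star\mu')\star\nu=\mu\star(\mu'\star\nu)$.
   Context: All uniform spaces are Hausdorff, all linear spaces are over $\mathbb{R}$. A semigroup $X$ with a uniform structure is a semiuniform semigroup if (a) the set of maps $\{x\mapsto xy : y\in X\}$ from $X$ to $X$ is uniformly equicontinuous, and (b) for each $x\in X$ the map $y\mapsto xy$ from $X$ to $X$ is uniformly continuous. (Equivalently, multiplication is uniformly continuous from Isbell's semiuniform product $X * X$ to $X$.) A semigroup $X$ endowed with a uniformity acts semiuniformly on a uniform space $Y$ if there is given a map $m:X\times Y\to Y$ with $m(s,m(s',y))=m(ss',y)$ for all $s,s'\in X$, $y\in Y$, that is uniformly continuous from the semiuniform product $X * Y$ to $Y$, i.e. such that the set of maps $\{x\mapsto m(x,y): y\in Y\}$ from $X$ to $Y$ is uniformly equicontinuous and for each $x\in X$ the map $y\mapsto m(x,y)$ is uniformly continuous. For a uniform space $X$, $\mathbf{U_b}(X)$ is the space of bounded uniformly continuous real-valued functions on $X$ with the sup norm, and $\mathbf{M}(X)$ is its norm dual. Convolution: if $X$ acts semiuniformly on $Y$ via $m$, then for $\mu\in\mathbf{M}(X)$, $\nu\in\mathbf{M}(Y)$ the element $\mu\star\nu\in\mathbf{M}(Y)$ is defined by $(\mu\star\nu)(f)=\mu\big(x\mapsto \nu(y\mapsto f(m(x,y)))\big)$ for $f\in\mathbf{U_b}(Y)$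 (the inner function of $x$ is in $\mathbf{U_b}(X)$). For a semiuniform semigroup $X$ and $\mu,\mu'\in\mathbf{M}(X)$, $\mu\star\mu'\in\mathbf{M}(X)$ is the special case $Y=X$, $m(x,y)=xy$. *)

theory Defs
  imports "HOL-Analysis.Analysis"
begin

section \<open>Uniform equicontinuity, semiuniform semigroups and semiuniform actions\<close>

definition uniformly_equicontinuous :: "('a::uniform_space \<Rightarrow> 'b::uniform_space) set \<Rightarrow> bool" where
  "uniformly_equicontinuous F \<longleftrightarrow>
     (\<forall>E. eventually E uniformity \<longrightarrow>
        eventually (\<lambda>(x, x'). \<forall>f\<in>F. E (f x, f x')) uniformity)"

text \<open>Uniform continuity of \<open>m\<close> on Isbell's semiuniform product of its two argument spaces.\<close>

definition semiuniformly_continuous ::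
    "('a::uniform_space \<Rightarrow> 'b::uniform_space \<Rightarrow> 'c::uniform_space) \<Rightarrow> bool" where
  "semiuniformly_continuous m \<longleftrightarrow>
     uniformly_equicontinuous {(\<lambda>x. m x y) | y. True} \<and>
     (\<forall>x. uniformly_continuous_on UNIV (\<lambda>y. m x y))"

text \<open>The sort \<^class>\<open>t2_space\<close> expresses that the uniformity is Hausdorff.\<close>

class uniform_semigroup = semigroup_mult + uniform_space + t2_space

class semiuniform_semigroup = uniform_semigroup +
  assumes semiuniformly_continuous_mult: "semiuniformly_continuous (\<lambda>x y :: 'a::uniform_semigroup. x * y)"

definition acts_semiuniformly ::
    "('x::{semigroup_mult, uniform_space} \<Rightarrow> 'y::uniform_space \<Rightarrow> 'y) \<Rightarrow> bool" where
  "acts_semiuniformly m \<longleftrightarrow>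
     (\<forall>s s' y. m s (m s' y) = m (s * s') y) \<and> semiuniformly_continuous m"


section \<open>The normed space of bounded uniformly continuous functions and its dual\<close>

typedef (overloaded) 'a ucb =
  "{f :: 'a::uniform_space \<Rightarrow> real. uniformly_continuous_on UNIV f \<and> bounded (range f)}"
  morphisms apply_ucb Ucb
  by (rule exI[of _ "\<lambda>_. 0"]) (auto simp: uniformly_continuous_on_const image_def)

setup_lifting type_definition_ucb

lemma uniformly_continuous_on_real_iff:
  fixes f :: "'a::uniform_space \<Rightarrow> real"
  shows "uniformly_continuous_on UNIV f \<longleftrightarrow>
    (\<forall>e>0. eventually (\<lambda>(x, y). \<bar>f x - f y\<bar> < e) uniformity)"
proof -
  have eq: "uniformly_continuous_on UNIV f \<longleftrightarrow>
      (\<forall>E. eventually E uniformity \<longrightarrow> eventually (\<lambda>(x, y). E (f x, f y)) uniformity)"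
    by (simp add: uniformly_continuous_on_uniformity filterlim_iff split_beta')
  show ?thesis
  proof (intro iffI allI impI)
    fix e :: real assume "uniformly_continuous_on UNIV f" "e > 0"
    moreover from \<open>e > 0\<close> have "eventually (\<lambda>(a, b). dist a b < e) (uniformity :: (real \<times> real) filter)"
      by (auto simp: eventually_uniformity_metric)
    ultimately have "eventually (\<lambda>(x, y). (\<lambda>(a, b). dist a b < e) (f x, f y)) uniformity"
      unfolding eq by blast
    then show "eventually (\<lambda>(x, y). \<bar>f x - f y\<bar> < e) uniformity"
      by (simp add: dist_real_def)
  next
    assume *: "\<forall>e>0. eventually (\<lambda>(x, y). \<bar>f x - f y\<bar> < e) uniformity"
    show "uniformly_continuous_on UNIV f"
      unfolding eq
    proof (intro allI impI)
      fix E :: "real \<times> real \<Rightarrow> bool" assume "eventually E uniformity"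
      then obtain e where "e > 0" and e: "\<And>a b. dist a b < e \<Longrightarrow> E (a, b)"
        by (auto simp: eventually_uniformity_metric)
      with * have "eventually (\<lambda>(x, y). \<bar>f x - f y\<bar> < e) uniformity" by blast
      then show "eventually (\<lambda>(x, y). E (f x, f y)) uniformity"
        by (rule eventually_mono) (auto intro: e simp: dist_real_def)
    qed
  qed
qed

lemma bounded_range_real_iff:
  fixes f :: "'a \<Rightarrow> real"
  shows "bounded (range f) \<longleftrightarrow> (\<exists>B. \<forall>x. \<bar>f x\<bar> \<le> B)"
  by (auto simp: bounded_iff)

instantiation ucb :: (uniform_space) real_vector
begin

lift_definition zero_ucb :: "'a ucb" is "\<lambda>_. 0"
  by (auto simp: uniformly_continuous_on_const image_def)

lift_definition plus_ucb :: "'a ucb \<Rightarrow> 'a ucb \<Rightarrow> 'a ucb" is "\<lambda>f g x. f x + g x"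
proof -
  fix f g :: "'a \<Rightarrow> real"
  assume f: "uniformly_continuous_on UNIV f \<and> bounded (range f)"
    and g: "uniformly_continuous_on UNIV g \<and> bounded (range g)"
  have "eventually (\<lambda>(x, y). \<bar>(f x + g x) - (f y + g y)\<bar> < e) uniformity" if "e > 0" for e
  proof -
    from that have "e/2 > 0" by simp
    then have "eventually (\<lambda>(x, y). \<bar>f x - f y\<bar> < e/2) uniformity"
      "eventually (\<lambda>(x, y). \<bar>g x - g y\<bar> < e/2) uniformity"
      using f g unfolding uniformly_continuous_on_real_iff by blast+
    then show ?thesis by eventually_elim (clarify, arith)
  qed
  moreover from f g have "bounded (range (\<lambda>x. f x + g x))"
    by (intro bounded_plus_comp) auto
  ultimately show "uniformly_continuous_on UNIV (\<lambda>x. f x + g x) \<and> bounded (range (\<lambda>x. f x + g x))"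
    by (auto simp: uniformly_continuous_on_real_iff)
qed

lift_definition scaleR_ucb :: "real \<Rightarrow> 'a ucb \<Rightarrow> 'a ucb" is "\<lambda>c f x. c * f x"
proof -
  fix c :: real and f :: "'a \<Rightarrow> real"
  assume f: "uniformly_continuous_on UNIV f \<and> bounded (range f)"
  have "eventually (\<lambda>(x, y). \<bar>c * f x - c * f y\<bar> < e) uniformity" if "e > 0" for e
  proof -
    from that have "e / (\<bar>c\<bar> + 1) > 0" by simp
    then have "eventually (\<lambda>(x, y). \<bar>f x - f y\<bar> < e / (\<bar>c\<bar> + 1)) uniformity"
      using f unfolding uniformly_continuous_on_real_iff by blast
    then show ?thesis
    proof (rule eventually_mono, clarify)
      fix x y assume "\<bar>f x - f y\<bar> < e / (\<bar>c\<bar> + 1)"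
      then have "(\<bar>c\<bar> + 1) * \<bar>f x - f y\<bar> < e"
        by (simp add: pos_less_divide_eq mult.commute)
      moreover have "\<bar>c * f x - c * f y\<bar> = \<bar>c\<bar> * \<bar>f x - f y\<bar>"
        by (simp only: abs_mult right_diff_distrib[symmetric])
      moreover have "\<bar>c\<bar> * \<bar>f x - f y\<bar> \<le> (\<bar>c\<bar> + 1) * \<bar>f x - f y\<bar>"
        by (rule mult_right_mono) auto
      ultimately show "\<bar>c * f x - c * f y\<bar> < e" by linarith
    qed
  qed
  moreover from f have "bounded (range (\<lambda>x. c * f x))"
    using bounded_scaleR_comp[of f UNIV c] by simp
  ultimately show "uniformly_continuous_on UNIV (\<lambda>x. c * f x) \<and> bounded (range (\<lambda>x. c * f x))"
    by (auto simp: uniformly_continuous_on_real_iff)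
qed

definition uminus_ucb :: "'a ucb \<Rightarrow> 'a ucb" where "uminus_ucb f = (- 1) *\<^sub>R f"

definition minus_ucb :: "'a ucb \<Rightarrow> 'a ucb \<Rightarrow> 'a ucb" where "minus_ucb f g = f + (- 1) *\<^sub>R g"

instance
  by standard
    (simp_all add: uminus_ucb_def minus_ucb_def apply_ucb_inject[symmetric] fun_eq_iff
      plus_ucb.rep_eq scaleR_ucb.rep_eq zero_ucb.rep_eq algebra_simps)

end

lemma apply_ucb_simps [simp]:
  "apply_ucb 0 x = 0"
  "apply_ucb (f + g) x = apply_ucb f x + apply_ucb g x"
  "apply_ucb (c *\<^sub>R f) x = c * apply_ucb f x"
  "apply_ucb (- f) x = - apply_ucb f x"
  "apply_ucb (f - g) x = apply_ucb f x - apply_ucb g x"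
  by (simp_all only: uminus_ucb_def minus_ucb_def plus_ucb.rep_eq scaleR_ucb.rep_eq zero_ucb.rep_eq mult_minus1
      diff_conv_add_uminus)

lemma ucb_eqI: "(\<And>x. apply_ucb f x = apply_ucb g x) \<Longrightarrow> f = g"
  by (simp add: apply_ucb_inject[symmetric] fun_eq_iff)

lemma bdd_above_ucb: "bdd_above (range (\<lambda>x. \<bar>apply_ucb f x\<bar>))"
  using apply_ucb[of f] by (auto simp: bounded_range_real_iff bdd_above_def)

instantiation ucb :: (uniform_space) real_normed_vector
begin

definition norm_ucb :: "'a ucb \<Rightarrow> real" where "norm_ucb f = (SUP x. \<bar>apply_ucb f x\<bar>)"

definition sgn_ucb :: "'a ucb \<Rightarrow> 'a ucb" where "sgn_ucb f = f /\<^sub>R norm f"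

definition dist_ucb :: "'a ucb \<Rightarrow> 'a ucb \<Rightarrow> real" where "dist_ucb f g = norm (f - g)"

definition uniformity_ucb :: "('a ucb \<times> 'a ucb) filter"
  where "uniformity_ucb = (INF e\<in>{0 <..}. principal {(f, g). dist f g < e})"

definition open_ucb :: "'a ucb set \<Rightarrow> bool"
  where "open_ucb S = (\<forall>f\<in>S. \<forall>\<^sub>F (f', g) in uniformity. f' = f \<longrightarrow> g \<in> S)"

instance
proof
  fix f g :: "'a ucb" and c :: real
  have upper: "\<bar>apply_ucb h x\<bar> \<le> norm h" for h :: "'a ucb" and x
    unfolding norm_ucb_def by (rule cSUP_upper[OF UNIV_I bdd_above_ucb])
  have least: "norm h \<le> B" if "\<And>x. \<bar>apply_ucb h x\<bar> \<le> B" for h :: "'a ucb" and B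
    unfolding norm_ucb_def using that by (intro cSUP_least) auto
  show "norm f = 0 \<longleftrightarrow> f = 0"
  proof
    assume "norm f = 0"
    with upper[of f] show "f = 0" by (intro ucb_eqI) simp
  qed (simp add: norm_ucb_def)
  show "norm (f + g) \<le> norm f + norm g"
  proof (rule least)
    fix x
    show "\<bar>apply_ucb (f + g) x\<bar> \<le> norm f + norm g"
      using upper[of f x] upper[of g x] by simp
  qed
  have scale_le: "norm (a *\<^sub>R h) \<le> \<bar>a\<bar> * norm h" for a and h :: "'a ucb"
    by (rule least) (simp add: abs_mult mult_left_mono upper)
  show "norm (c *\<^sub>R f) = \<bar>c\<bar> * norm f"
  proof (cases "c = 0")
    case True
    then show ?thesis by (simp add: norm_ucb_def)
  next
    case False
    then have "norm f \<le> \<bar>inverse c\<bar> * norm (c *\<^sub>R f)"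
      using scale_le[of "inverse c" "c *\<^sub>R f"] by simp
    then have "\<bar>c\<bar> * norm f \<le> \<bar>c\<bar> * (\<bar>inverse c\<bar> * norm (c *\<^sub>R f))"
      by (rule mult_left_mono) simp
    also have "\<dots> = norm (c *\<^sub>R f)"
      using False by (simp only: mult.assoc[symmetric] abs_mult[symmetric]) simp
    finally have "\<bar>c\<bar> * norm f \<le> norm (c *\<^sub>R f)" .
    with scale_le[of c f] show ?thesis by linarith
  qed
qed (rule sgn_ucb_def dist_ucb_def uniformity_ucb_def open_ucb_def)+

end

lemma abs_apply_ucb_le_norm: "\<bar>apply_ucb f x\<bar> \<le> norm f"
  unfolding norm_ucb_def by (rule cSUP_upper[OF UNIV_I bdd_above_ucb])

lemma norm_ucb_le: "(\<And>x. \<bar>apply_ucb f x\<bar> \<le> B) \<Longrightarrow> norm f \<le> B"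
  unfolding norm_ucb_def by (intro cSUP_least) auto

type_synonym 'a ucb_dual = "'a ucb \<Rightarrow>\<^sub>L real"


section \<open>Convolution\<close>

text \<open>
  The abstraction functions \<^const>\<open>Ucb\<close> and \<^const>\<open>Blinfun\<close> are meaningful only on bounded
  uniformly continuous functions and on bounded linear maps, respectively.  For semiuniformly
  continuous \<open>m\<close> their arguments are of this kind: see \<open>convolution_inner\<close>,
  \<open>convolution_outer\<close>, \<open>bounded_linear_convolution\<close> and \<open>convolution_apply\<close> below.
\<close>

definition convolution ::
    "('x::uniform_space \<Rightarrow> 'y::uniform_space \<Rightarrow> 'y) \<Rightarrow> 'x ucb_dual \<Rightarrow> 'y ucb_dual \<Rightarrow> 'y ucb_dual" where
  "convolution m \<mu> \<nu> =
     Blinfun (\<lambda>f. blinfun_apply \<mu> (Ucb (\<lambda>x. blinfun_apply \<nu> (Ucb (\<lambda>y. apply_ucb f (m x y))))))"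

lemma apply_ucb_Ucb:
  "uniformly_continuous_on UNIV f \<Longrightarrow> bounded (range f) \<Longrightarrow> apply_ucb (Ucb f) = f"
  by (simp add: Ucb_inverse)

lemma convolution_inner:
  assumes "semiuniformly_continuous m"
  shows "uniformly_continuous_on UNIV (\<lambda>y. apply_ucb f (m x y))"
    and "bounded (range (\<lambda>y. apply_ucb f (m x y)))"
proof -
  have "uniformly_continuous_on UNIV (m x)"
    using assms by (simp add: semiuniformly_continuous_def)
  moreover have "uniformly_continuous_on (range (m x)) (apply_ucb f)"
    using apply_ucb[of f] unfolding uniformly_continuous_on_uniformity
    by (auto elim!: filterlim_mono intro!: inf_mono)
  ultimately show "uniformly_continuous_on UNIV (\<lambda>y. apply_ucb f (m x y))"
    by (rule uniformly_continuous_on_compose)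
  show "bounded (range (\<lambda>y. apply_ucb f (m x y)))"
    using abs_apply_ucb_le_norm[of f] by (auto simp: bounded_range_real_iff)
qed

lemma apply_ucb_convolution_inner:
  "semiuniformly_continuous m \<Longrightarrow>
    apply_ucb (Ucb (\<lambda>y. apply_ucb f (m x y))) y = apply_ucb f (m x y)"
  by (simp add: apply_ucb_Ucb convolution_inner)

lemma convolution_inner_norm_le:
  "semiuniformly_continuous m \<Longrightarrow> norm (Ucb (\<lambda>y. apply_ucb f (m x y))) \<le> norm f"
  by (rule norm_ucb_le) (simp add: apply_ucb_convolution_inner abs_apply_ucb_le_norm)

lemma convolution_inner_abs_le:
  fixes \<nu> :: "'y::uniform_space ucb_dual"
  assumes "semiuniformly_continuous m"
  shows "\<bar>blinfun_apply \<nu> (Ucb (\<lambda>y. apply_ucb f (m x y)))\<bar> \<le> norm \<nu> * norm f"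
  using norm_blinfun[of \<nu> "Ucb (\<lambda>y. apply_ucb f (m x y))"]
    mult_left_mono[OF convolution_inner_norm_le[OF assms, of f x] norm_ge_zero[of \<nu>]]
  by simp

lemma convolution_outer:
  fixes \<nu> :: "'y::uniform_space ucb_dual"
  assumes m: "semiuniformly_continuous m"
  shows "uniformly_continuous_on UNIV (\<lambda>x. blinfun_apply \<nu> (Ucb (\<lambda>y. apply_ucb f (m x y))))"
    and "bounded (range (\<lambda>x. blinfun_apply \<nu> (Ucb (\<lambda>y. apply_ucb f (m x y)))))"
proof -
  let ?g = "\<lambda>x. Ucb (\<lambda>y. apply_ucb f (m x y))"
  show "uniformly_continuous_on UNIV (\<lambda>x. blinfun_apply \<nu> (?g x))"
  proof (rule uniformly_continuous_on_real_iff[THEN iffD2], intro allI impI)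
    fix e :: real assume "e > 0"
    define d where "d = e / (norm \<nu> + 1)"
    have "norm \<nu> + 1 > 0" by (simp add: add_nonneg_pos)
    with \<open>e > 0\<close> have "d > 0" by (simp add: d_def)
    then have "eventually (\<lambda>(a, b). \<bar>apply_ucb f a - apply_ucb f b\<bar> < d) uniformity"
      using apply_ucb[of f] by (auto simp: uniformly_continuous_on_real_iff)
    then have "eventually (\<lambda>(x, x'). \<forall>h\<in>{(\<lambda>x. m x y) | y. True}.
        (\<lambda>(a, b). \<bar>apply_ucb f a - apply_ucb f b\<bar> < d) (h x, h x')) uniformity"
      using m unfolding semiuniformly_continuous_def uniformly_equicontinuous_def by blast
    then show "eventually (\<lambda>(x, x'). \<bar>blinfun_apply \<nu> (?g x) - blinfun_apply \<nu> (?g x')\<bar> < e) uniformity"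
    proof (rule eventually_mono, clarify)
      fix x x'
      assume *: "\<forall>h\<in>{\<lambda>x. m x y |y. True}. \<bar>apply_ucb f (h x) - apply_ucb f (h x')\<bar> < d"
      then have "\<bar>apply_ucb f (m x y) - apply_ucb f (m x' y)\<bar> < d" for y
        by auto
      then have "norm (?g x - ?g x') \<le> d"
        by (intro norm_ucb_le) (simp add: apply_ucb_convolution_inner[OF m] less_imp_le)
      then have "norm \<nu> * norm (?g x - ?g x') \<le> norm \<nu> * d"
        by (simp add: mult_left_mono)
      moreover have "norm \<nu> * d < e"
        using \<open>e > 0\<close> \<open>norm \<nu> + 1 > 0\<close> by (simp add: d_def field_simps)
      ultimately show "\<bar>blinfun_apply \<nu> (?g x) - blinfun_apply \<nu> (?g x')\<bar> < e"
        using norm_blinfun[of \<nu> "?g x - ?g x'"] by (simp add: blinfun.diff_right)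
    qed
  qed
  show "bounded (range (\<lambda>x. blinfun_apply \<nu> (?g x)))"
    using convolution_inner_abs_le[OF m] by (auto simp: bounded_range_real_iff)
qed

lemma bounded_linear_convolution:
  fixes \<mu> :: "'x::uniform_space ucb_dual" and \<nu> :: "'y::uniform_space ucb_dual"
  assumes m: "semiuniformly_continuous m"
  shows "bounded_linear
    (\<lambda>f. blinfun_apply \<mu> (Ucb (\<lambda>x. blinfun_apply \<nu> (Ucb (\<lambda>y. apply_ucb f (m x y))))))"
proof -
  let ?g = "\<lambda>f x. Ucb (\<lambda>y. apply_ucb f (m x y))"
  let ?h = "\<lambda>f. Ucb (\<lambda>x. blinfun_apply \<nu> (?g f x))"
  have h: "apply_ucb (?h f) x = blinfun_apply \<nu> (?g f x)" for f x
    by (simp add: apply_ucb_Ucb convolution_outer[OF m])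
  have g_add: "?g (f + f') x = ?g f x + ?g f' x" for f f' x
    by (rule ucb_eqI, simp only: apply_ucb_convolution_inner[OF m])
      (simp add: apply_ucb_convolution_inner[OF m])
  have g_scale: "?g (c *\<^sub>R f) x = c *\<^sub>R ?g f x" for c f x
    by (rule ucb_eqI, simp only: apply_ucb_convolution_inner[OF m])
      (simp add: apply_ucb_convolution_inner[OF m])
  have h_add: "?h (f + f') = ?h f + ?h f'" for f f'
    by (rule ucb_eqI, simp only: h, simp only: g_add blinfun.add_right)
      (simp only: apply_ucb_simps h)
  have h_scale: "?h (c *\<^sub>R f) = c *\<^sub>R ?h f" for c f
    by (rule ucb_eqI, simp only: h, simp only: g_scale blinfun.scaleR_right real_scaleR_def)
      (simp only: apply_ucb_simps h)
  show ?thesis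
  proof (rule bounded_linear_intro[where K = "norm \<mu> * norm \<nu>"])
    fix f f'
    show "blinfun_apply \<mu> (?h (f + f')) = blinfun_apply \<mu> (?h f) + blinfun_apply \<mu> (?h f')"
      by (simp only: h_add blinfun.add_right)
  next
    fix c f
    show "blinfun_apply \<mu> (?h (c *\<^sub>R f)) = c *\<^sub>R blinfun_apply \<mu> (?h f)"
      by (simp only: h_scale blinfun.scaleR_right)
  next
    fix f
    have "norm (?h f) \<le> norm \<nu> * norm f"
      by (rule norm_ucb_le) (simp only: h convolution_inner_abs_le[OF m])
    then have "norm \<mu> * norm (?h f) \<le> norm \<mu> * (norm \<nu> * norm f)"
      by (simp add: mult_left_mono)
    with norm_blinfun[of \<mu> "?h f"]
    show "norm (blinfun_apply \<mu> (?h f)) \<le> norm f * (norm \<mu> * norm \<nu>)"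
      by (simp add: mult_ac)
  qed
qed

lemma convolution_apply:
  assumes "semiuniformly_continuous m"
  shows "blinfun_apply (convolution m \<mu> \<nu>) f =
    blinfun_apply \<mu> (Ucb (\<lambda>x. blinfun_apply \<nu> (Ucb (\<lambda>y. apply_ucb f (m x y)))))"
  by (simp add: convolution_def bounded_linear_Blinfun_apply bounded_linear_convolution assms)

end

theory Submission
  imports Defs
begin

text \<open>
  Evaluated at a test function \<open>f\<close>, both sides become the same iterated functional: \<open>\<nu>\<close> is applied
  in the variable \<open>y\<close>, then \<open>\<mu>'\<close> in \<open>x'\<close>, then \<open>\<mu>\<close> in \<open>x\<close>. In both cases \<open>\<mu>\<close> is outermost and \<open>\<nu>\<close>
  innermost, so no interchange of functionals (which would fail for general elements of the dual) is
  involved; the two expressions differ only in the integrand, which is \<open>f (m (x * x') y)\<close> on the left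
  and \<open>f (m x (m x' y))\<close> on the right. Semiuniform continuity of \<open>m\<close> and of the multiplication
  guarantees that every intermediate function is bounded and uniformly continuous, hence a legitimate
  argument of the next functional.
\<close>

theorem theorem2p1:
  fixes m :: "'x::semiuniform_semigroup \<Rightarrow> 'y::{uniform_space, t2_space} \<Rightarrow> 'y"
    and \<mu> \<mu>' :: "'x ucb_dual" and \<nu> :: "'y ucb_dual"
  assumes "acts_semiuniformly m"
  shows "convolution m (convolution (\<lambda>x y. x * y) \<mu> \<mu>') \<nu> = convolution m \<mu> (convolution m \<mu>' \<nu>)"
proof (rule blinfun_eqI)
  fix f :: "'y ucb"
  have m: "semiuniformly_continuous m" and action: "m x (m x' y) = m (x * x') y" for x x' y
    using assms by (simp_all add: acts_semiuniformly_def)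
  let ?g = "\<lambda>x. Ucb (\<lambda>y. apply_ucb f (m x y))"
  have "blinfun_apply (convolution m (convolution (\<lambda>x y. x * y) \<mu> \<mu>') \<nu>) f =
      blinfun_apply \<mu> (Ucb (\<lambda>x. blinfun_apply \<mu>' (Ucb (\<lambda>x'. blinfun_apply \<nu> (?g (x * x'))))))"
    by (simp add: convolution_apply m semiuniformly_continuous_mult apply_ucb_Ucb convolution_outer)
  also have "\<dots> = blinfun_apply (convolution m \<mu> (convolution m \<mu>' \<nu>)) f"
    by (simp add: convolution_apply m apply_ucb_convolution_inner action)
  finally show "blinfun_apply (convolution m (convolution (\<lambda>x y. x * y) \<mu> \<mu>') \<nu>) f =
      blinfun_apply (convolution m \<mu> (convolution m \<mu>' \<nu>)) f" .
qed

end
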